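(* Let $k\ge 2$, $n\ge 1$, and let $\mathbf{S}\subseteq\Sigma_k^n$ be nonempty. Let $\mathbf{S}_1,\mathbf{S}_2,\ldots,\mathbf{S}_m$ be a UC-partition of $\mathbf{S}$ with universal cycles $\alpha_1,\alpha_2,\ldots,\alpha_m$ (so $\alpha_i$ is a universal cycle for $\mathbf{S}_i$), let $x$ be the first symbol of $\alpha_1$, and let $\mathcal{U}_{m,n}=\alpha_1\alpha_2\cdots\alpha_m$. Suppose that: (1) $|\alpha_1|\ge n$; (2) the length of the maximal prefix of $\alpha_1$ consisting only of the symbol $x$ is at least the length of the maximal prefix consisting only of $x$ of every $\alpha_i$, $1\le i\le m$; (3) for each $1\le i<m$, the pair $(\text{ext}_n(\alpha_i),\text{ext}_n(\alpha_{i+1}))$ is suffix-related with respect to $(x,n)$. Then $\mathcal{U}_{m,n}$ is a universal cycle for $\mathbf{S}$, and $\text{suff}_n(\mathcal{U}_{m,n})=\text{suff}_n(\text{ext}_n(\alpha_m))$.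
   Context: $\Sigma_k=\{0,1,\ldots,k-1\}$ and $\Sigma_k^n$ is the set of strings of length $n$ over $\Sigma_k$. For a nonempty $\mathbf{S}\subseteq\Sigma_k^n$, a universal cycle for $\mathbf{S}$ is a string of length $|\mathbf{S}|$ which, viewed cyclically, contains every string of $\mathbf{S}$ as a (length-$n$, possibly wrapping around) substring exactly once. A partition of $\mathbf{S}$ into subsets $\mathbf{S}_1,\ldots,\mathbf{S}_m$ is a UC-partition if each $\mathbf{S}_i$ has a universal cycle. For a string $\alpha$ of length at least $\ell$, $\text{suff}_\ell(\alpha)$ and $\text{pre}_\ell(\alpha)$ denote its length-$\ell$ suffix and prefix ($\text{suff}_0$ is the empty string). For a nonempty string $\alpha$, $\text{ext}_n(\alpha)=\alpha^t$ (concatenation of $t$ copies) where $t$ is the smallest integer with $t|\alpha|\ge n$. Suffix-related: let $\alpha=a_1\cdots a_s$, $\beta=b_1\cdots b_t$ with $s,t\ge n>0$ and $x\in\Sigma_k$; let $j$ be the smallest index with $b_j\ne x$ ($j=\infty$ if none). Then $(\alpha,\beta)$ is suffix-related with respect to $(x,n)$ if $j\le n$ and $\text{suff}_{n-j}(\alpha)=\text{suff}_{n-j}(\beta)$. *)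

theory Defs
  imports Main "HOL-Library.Disjoint_Sets"
begin

definition words :: "nat \<Rightarrow> nat \<Rightarrow> nat list set" where
  "words k n = {w. set w \<subseteq> {..<k} \<and> length w = n}"

(* The window may be longer than w, in which case it wraps around several times. *)
definition cyclic_window :: "nat \<Rightarrow> 'a list \<Rightarrow> nat \<Rightarrow> 'a list" where
  "cyclic_window n w i = map (\<lambda>j. w ! ((i + j) mod length w)) [0..<n]"

definition universal_cycle :: "nat \<Rightarrow> nat \<Rightarrow> nat list set \<Rightarrow> nat list \<Rightarrow> bool" where
  "universal_cycle k n S w \<longleftrightarrow>
     S \<noteq> {} \<and> S \<subseteq> words k n \<and> set w \<subseteq> {..<k} \<and> length w = card S \<and>
     (\<forall>u\<in>S. \<exists>!i. i < length w \<and> cyclic_window n w i = u)"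

definition UC_partition :: "nat \<Rightarrow> nat \<Rightarrow> nat list set \<Rightarrow> nat list set list \<Rightarrow> bool" where
  "UC_partition k n S Ss \<longleftrightarrow>
     partition_on S (set Ss) \<and> distinct Ss \<and> (\<forall>T\<in>set Ss. \<exists>w. universal_cycle k n T w)"

definition suff :: "nat \<Rightarrow> 'a list \<Rightarrow> 'a list" where
  "suff l w = drop (length w - l) w"

definition ext :: "nat \<Rightarrow> 'a list \<Rightarrow> 'a list" where
  "ext n w = concat (replicate (LEAST t. n \<le> t * length w) w)"

(* The index j is 1-based, so the j-th symbol of b is b ! (j - 1). *)
definition suffix_related :: "'a \<Rightarrow> nat \<Rightarrow> 'a list \<Rightarrow> 'a list \<Rightarrow> bool" where
  "suffix_related x n a b \<longleftrightarrow>
     n > 0 \<and> n \<le> length a \<and> n \<le> length b \<and>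
     (\<exists>j. 1 \<le> j \<and> j \<le> length b \<and> b ! (j - 1) \<noteq> x \<and> (\<forall>i. 1 \<le> i \<and> i < j \<longrightarrow> b ! (i - 1) = x) \<and>
          j \<le> n \<and> suff (n - j) a = suff (n - j) b)"

definition run_prefix_length :: "'a \<Rightarrow> 'a list \<Rightarrow> nat" where
  "run_prefix_length x w = length (takeWhile (\<lambda>a. a = x) w)"

end

theory Submission
  imports Defs
begin

text \<open>
  Write \<open>U\<close> for \<open>\<alpha>\<^sub>1 \<dots> \<alpha>\<^sub>i\<close> and \<open>\<beta>\<close> for \<open>\<alpha>\<^sub>i\<^sub>+\<^sub>1\<close>, and compare windows by the position of
  their last symbol. Let \<open>j\<close> be the (1-based) index of the first symbol of \<open>\<beta>\<close> other than \<open>x\<close>.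
  Suffix-relatedness says that the \<open>n - j\<close> symbols cyclically preceding \<open>U\<close> and \<open>\<beta>\<close> agree, so
  a window of \<open>U\<close> or \<open>\<beta>\<close> ending at index \<open>j\<close> or later is unchanged in \<open>U\<beta>\<close>. The
  remaining windows end within the first \<open>j - 1\<close> symbols, which are all \<open>x\<close> in both words;
  concatenation swaps these windows of \<open>U\<close> with those of \<open>\<beta>\<close>. Hence \<open>U\<beta>\<close> contains all windows
  of both words, and by counting it contains each exactly once.
\<close>

section \<open>Cyclic positions and windows\<close>

definition cyc :: "'a list \<Rightarrow> int \<Rightarrow> 'a" where
  "cyc w z = w ! nat (z mod int (length w))"

text \<open>Positions are integers so that negative ones denote the symbols cyclically preceding the
  word. Listing the window backwards from its last symbol reduces equality of windows to comparing
  symbols at each distance \<open>d < n\<close>.\<close>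

definition window_ending :: "nat \<Rightarrow> 'a list \<Rightarrow> int \<Rightarrow> 'a list" where
  "window_ending n w p = rev (map (\<lambda>d. cyc w (p - int d)) [0..<n])"

lemma cyc_nonneg: "z < length w \<Longrightarrow> cyc w (int z) = w ! z"
  by (simp add: cyc_def)

lemma cyc_neg:
  assumes "1 \<le> d" "d \<le> length w"
  shows "cyc w (- int d) = w ! (length w - d)"
proof -
  have "(- int d) mod int (length w) = (- int d + int (length w)) mod int (length w)"
    by simp
  also have "\<dots> = int (length w - d)"
    using assms by (subst mod_pos_pos_trivial) auto
  finally show ?thesis
    by (simp add: cyc_def)
qed

lemma cyc_add_length: "cyc w (z + int (length w)) = cyc w z"
  by (simp add: cyc_def)

lemma cyc_mod_length: "cyc w (z mod int (length w) + a) = cyc w (z + a)"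
  by (simp add: cyc_def mod_simps)

lemma cyclic_window_eq_window_ending:
  "cyclic_window n w i = window_ending n w (int i + int n - 1)"
proof (rule nth_equalityI)
  fix l assume "l < length (cyclic_window n w i)"
  then have l: "l < n" by (simp add: cyclic_window_def)
  have "cyc w (int (i + l)) = w ! ((i + l) mod length w)"
    unfolding cyc_def zmod_int[symmetric] by simp
  moreover have "int i + int n - 1 - int (n - Suc l) = int (i + l)"
    using l by simp
  ultimately show "cyclic_window n w i ! l = window_ending n w (int i + int n - 1) ! l"
    using l by (simp add: cyclic_window_def window_ending_def rev_nth)
qed (simp add: cyclic_window_def window_ending_def)

lemma window_ending_mod_length:
  "window_ending n w (p mod int (length w)) = window_ending n w p"
  by (simp add: window_ending_def cyc_mod_length[of w p "- int d" for d, simplified])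

lemma window_ending_in_cyclic_windows:
  assumes "w \<noteq> []"
  shows "window_ending n w p \<in> cyclic_window n w ` {..<length w}"
proof -
  \<comment> \<open>The window ending at \<open>p\<close> starts at \<open>p - n + 1\<close>, here
    reduced to a valid index.\<close>
  define i where "i = nat ((p - int n + 1) mod int (length w))"
  have i: "int i = (p - int n + 1) mod int (length w)"
    using assms by (simp add: i_def)
  have "i < length w"
    using assms i by (metis length_greater_0_conv of_nat_0_less_iff of_nat_less_iff pos_mod_bound)
  moreover have "window_ending n w (int i + int n - 1) = window_ending n w p"
  proof -
    have "(int i + int n - 1) mod int (length w) = ((p - int n + 1) + (int n - 1)) mod int (length w)"
      unfolding i by (metis add_diff_eq mod_add_left_eq)
    also have "(p - int n + 1) + (int n - 1) = p" by simp
    finally show ?thesis by (metis window_ending_mod_length)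
  qed
  ultimately show ?thesis
    by (metis cyclic_window_eq_window_ending imageI lessThan_iff)
qed

text \<open>Starts and ends of windows differ by a fixed shift modulo the length. So it suffices to
  treat ends \<open>p\<close> inside \<open>w\<close>, and the matching end \<open>q\<close> in
  \<open>v\<close> may be any integer.\<close>

lemma cyclic_windows_subsetI:
  assumes "\<And>p. p < length w \<Longrightarrow> \<exists>q. window_ending n w (int p) = window_ending n v q"
    and "v \<noteq> []"
  shows "cyclic_window n w ` {..<length w} \<subseteq> cyclic_window n v ` {..<length v}"
proof
  fix u assume "u \<in> cyclic_window n w ` {..<length w}"
  then obtain i where i: "i < length w" "u = window_ending n w (int i + int n - 1)"
    by (auto simp: cyclic_window_eq_window_ending)
  define p where "p = nat ((int i + int n - 1) mod int (length w))"
  have p: "int p = (int i + int n - 1) mod int (length w)"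
    unfolding p_def using i(1) pos_mod_sign[of "int (length w)" "int i + int n - 1"] by linarith
  have "int p < int (length w)"
    unfolding p using i(1) by (intro pos_mod_bound) auto
  then obtain q where "window_ending n w (int p) = window_ending n v q"
    using assms(1)[of p] by auto
  then have "u = window_ending n v q"
    by (simp only: i(2) p window_ending_mod_length)
  then show "u \<in> cyclic_window n v ` {..<length v}"
    using window_ending_in_cyclic_windows[OF assms(2)] by simp
qed

section \<open>Universal cycles by counting\<close>

lemma finite_words: "finite (words k n)"
  unfolding words_def by (rule finite_lists_length_eq) simp

lemma universal_cycle_finite: "universal_cycle k n S w \<Longrightarrow> finite S"
  using finite_words finite_subset unfolding universal_cycle_def by blast

lemma universal_cycle_nonempty: "universal_cycle k n S w \<Longrightarrow> w \<noteq> []"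
  using universal_cycle_finite[of k n S w] unfolding universal_cycle_def by auto

text \<open>A word of length \<open>card S\<close> has exactly as many window positions as
  \<open>S\<close> has elements. If its windows cover \<open>S\<close>, the map from positions to
  windows is injective, so uniqueness comes for free.\<close>

lemma universal_cycle_iff_subset_windows:
  "universal_cycle k n S w \<longleftrightarrow>
     S \<noteq> {} \<and> S \<subseteq> words k n \<and> set w \<subseteq> {..<k} \<and> length w = card S \<and>
     S \<subseteq> cyclic_window n w ` {..<length w}"
proof -
  have "\<exists>!i. i < length w \<and> cyclic_window n w i = u"
    if len: "length w = card S" and sub: "S \<subseteq> cyclic_window n w ` {..<length w}" and u: "u \<in> S" for u
  proof -
    let ?W = "cyclic_window n w ` {..<length w}"
    have "card ?W \<le> card S"
      using card_image_le[of "{..<length w}" "cyclic_window n w"] len by simp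
    moreover have "card S \<le> card ?W"
      using sub by (intro card_mono) auto
    ultimately have "inj_on (cyclic_window n w) {..<length w}"
      using len by (intro eq_card_imp_inj_on) auto
    with sub u show ?thesis
      by (auto simp: inj_on_def)
  qed
  then show ?thesis
    unfolding universal_cycle_def by (smt (verit) image_iff lessThan_iff subset_iff)
qed

section \<open>Suffixes, repeated words and suffix-relatedness\<close>

lemma suff_eq_iff:
  assumes "l \<le> length a" "l \<le> length b"
  shows "suff l a = suff l b \<longleftrightarrow>
    (\<forall>d. 1 \<le> d \<and> d \<le> l \<longrightarrow> a ! (length a - d) = b ! (length b - d))"
proof
  assume eq: "suff l a = suff l b"
  show "\<forall>d. 1 \<le> d \<and> d \<le> l \<longrightarrow> a ! (length a - d) = b ! (length b - d)"
  proof (intro allI impI)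
    fix d assume d: "1 \<le> d \<and> d \<le> l"
    have "suff l a ! (l - d) = suff l b ! (l - d)" using eq by simp
    then show "a ! (length a - d) = b ! (length b - d)"
      using d assms by (simp add: suff_def)
  qed
next
  assume *: "\<forall>d. 1 \<le> d \<and> d \<le> l \<longrightarrow> a ! (length a - d) = b ! (length b - d)"
  show "suff l a = suff l b"
  proof (rule nth_equalityI)
    fix i assume "i < length (suff l a)"
    then have "i < l" using assms by (simp add: suff_def)
    then show "suff l a ! i = suff l b ! i"
      using *[rule_format, of "l - i"] assms by (simp add: suff_def)
  qed (use assms in \<open>simp add: suff_def\<close>)
qed

lemma length_concat_replicate: "length (concat (replicate t w)) = t * length w"
  by (induction t) auto

lemma nth_concat_replicate:
  "i < t * length w \<Longrightarrow> concat (replicate t w) ! i = w ! (i mod length w)"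
proof (induction t arbitrary: i)
  case (Suc t)
  then show ?case
    by (cases "i < length w") (auto simp: nth_append le_mod_geq)
qed simp

lemma length_ext:
  assumes "w \<noteq> []"
  shows "length (ext n w) = (LEAST t. n \<le> t * length w) * length w" "n \<le> length (ext n w)"
proof -
  show *: "length (ext n w) = (LEAST t. n \<le> t * length w) * length w"
    by (simp add: ext_def length_concat_replicate)
  \<comment> \<open>The value \<open>t = n\<close> shows that the set under \<open>LEAST\<close> is
    nonempty.\<close>
  have "n \<le> n * length w"
    using assms by (cases w) auto
  then show "n \<le> length (ext n w)"
    unfolding * by (rule LeastI)
qed

lemma nth_ext: "i < length (ext n w) \<Longrightarrow> ext n w ! i = w ! (i mod length w)"
  unfolding ext_def by (simp add: length_concat_replicate nth_concat_replicate)

text \<open>The length of \<open>ext n w\<close> is a multiple of \<open>length w\<close>, so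
  counting back from its end is counting back cyclically from the start of \<open>w\<close>. This
  turns conditions on suffixes into conditions on negative cyclic positions.\<close>

lemma nth_ext_from_end:
  assumes "w \<noteq> []" "1 \<le> d" "d \<le> length (ext n w)"
  shows "ext n w ! (length (ext n w) - d) = cyc w (- int d)"
proof -
  let ?E = "length (ext n w)"
  have "ext n w ! (?E - d) = w ! ((?E - d) mod length w)"
    using assms by (intro nth_ext) auto
  also have "\<dots> = cyc w (int (?E - d))"
    unfolding cyc_def zmod_int[symmetric] by simp
  also have "int (?E - d) = int (LEAST t. n \<le> t * length w) * int (length w) + (- int d)"
    using assms by (simp add: length_ext(1))
  also have "cyc w \<dots> = cyc w (- int d)"
    unfolding cyc_def by (simp only: mod_mult_self3)
  finally show ?thesis .
qed

lemma suff_eq_suff_ext_iff: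
  assumes "l \<le> length u" "l \<le> length (ext n w)" "w \<noteq> []"
  shows "suff l u = suff l (ext n w) \<longleftrightarrow>
    (\<forall>d. 1 \<le> d \<and> d \<le> l \<longrightarrow> cyc u (- int d) = cyc w (- int d))"
proof -
  have "u ! (length u - d) = ext n w ! (length (ext n w) - d) \<longleftrightarrow> cyc u (- int d) = cyc w (- int d)"
    if "1 \<le> d" "d \<le> l" for d
    using that assms cyc_neg[of d u] nth_ext_from_end[of w d n] by simp
  then show ?thesis
    unfolding suff_eq_iff[OF assms(1,2)] by blast
qed

lemma nth_eq_of_run_prefix: "i < run_prefix_length x w \<Longrightarrow> w ! i = x"
  unfolding run_prefix_length_def using nth_mem set_takeWhileD takeWhile_nth by fastforce

text \<open>The parameter \<open>r\<close> is \<open>j - 1\<close> in the notation of the definition.\<close>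

lemma suffix_related_ext_obtain_run:
  assumes rel: "suffix_related x n (ext n v) (ext n w)" and "v \<noteq> []" "w \<noteq> []"
  obtains r where "r < n" "r < length w" "r = run_prefix_length x w" "\<And>i. i < r \<Longrightarrow> w ! i = x"
    "\<And>d. 1 \<le> d \<Longrightarrow> d < n - r \<Longrightarrow> cyc v (- int d) = cyc w (- int d)"
proof -
  from rel obtain j where j: "1 \<le> j" "j \<le> length (ext n w)" "ext n w ! (j - 1) \<noteq> x"
    "\<And>i. 1 \<le> i \<Longrightarrow> i < j \<Longrightarrow> ext n w ! (i - 1) = x" "j \<le> n"
    "suff (n - j) (ext n v) = suff (n - j) (ext n w)"
    unfolding suffix_related_def by blast
  define r where "r = j - 1"
  have r: "r < n" "r < length (ext n w)" using j by (auto simp: r_def)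
  have run: "w ! (i mod length w) = x" if "i < r" for i
    using j(4)[of "Suc i"] nth_ext[of i n w] that r by (simp add: r_def)
  have ne: "w ! (r mod length w) \<noteq> x"
    using j(3) nth_ext[OF r(2)] by (simp add: r_def)
  \<comment> \<open>Otherwise periodicity of \<open>ext n w\<close> would repeat the symbol at
    \<open>r\<close>, which is not \<open>x\<close>, at the smaller index
    \<open>r mod length w\<close> inside the run.\<close>
  have rw: "r < length w"
  proof (rule ccontr)
    assume "\<not> r < length w"
    then have "r mod length w < r"
      using \<open>w \<noteq> []\<close> by (metis length_greater_0_conv linorder_not_le mod_less_divisor order_less_le_trans)
    with run[of "r mod length w"] ne show False by simp
  qed
  have run': "w ! i = x" if "i < r" for i
    using run[OF that] that rw by simp
  have "length (takeWhile (\<lambda>a. a = x) w) = r"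
    using run' ne rw by (subst takeWhile_eq_take_P_nth[of r]) auto
  then have rl: "r = run_prefix_length x w"
    by (simp add: run_prefix_length_def)
  \<comment> \<open>As \<open>j = r + 1\<close>, the bound \<open>d < n - r\<close> means
    \<open>d \<le> n - j\<close>, the length of the common suffix.\<close>
  have "cyc v (- int d) = cyc w (- int d)" if "1 \<le> d" "d < n - r" for d
  proof -
    have d: "d \<le> n - j" "d \<le> length (ext n v)" "d \<le> length (ext n w)"
      using that length_ext(2)[OF assms(2), of n] length_ext(2)[OF assms(3), of n] by (auto simp: r_def)
    have "ext n v ! (length (ext n v) - d) = ext n w ! (length (ext n w) - d)"
      using iffD1[OF suff_eq_iff j(6)] d that(1) length_ext(2)[OF assms(2), of n]
        length_ext(2)[OF assms(3), of n] by auto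
    then show ?thesis
      using nth_ext_from_end assms(2,3) that(1) d by metis
  qed
  with that[OF r(1) rw rl run'] show thesis by blast
qed

lemma window_ending_cong:
  assumes "\<And>d. d < n \<Longrightarrow> cyc v (p - int d) = cyc w (q - int d)"
  shows "window_ending n v p = window_ending n w q"
  using assms by (simp add: window_ending_def)

section \<open>Windows of a concatenation of two words\<close>

context
  fixes U \<beta> :: "'a list" and x :: 'a and n r :: nat
  assumes n_le: "n \<le> length U"
    and r: "r < n" "r < length \<beta>"
    and run_U: "\<And>i. i < r \<Longrightarrow> U ! i = x"
    and run_\<beta>: "\<And>i. i < r \<Longrightarrow> \<beta> ! i = x"
    and before: "\<And>d. 1 \<le> d \<Longrightarrow> d < n - r \<Longrightarrow> cyc U (- int d) = cyc \<beta> (- int d)"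
begin

lemma cyc_append_left: "z < length U \<Longrightarrow> cyc (U @ \<beta>) (int z) = U ! z"
  by (simp add: cyc_nonneg nth_append)

lemma cyc_append_right: "z < length \<beta> \<Longrightarrow> cyc (U @ \<beta>) (int (length U) + int z) = \<beta> ! z"
  using cyc_nonneg[of "length U + z" "U @ \<beta>"] by simp

lemma cyc_append_before_right:
  assumes "1 \<le> d" "d \<le> n"
  shows "cyc (U @ \<beta>) (int (length U) - int d) = cyc U (- int d)"
  using cyc_append_left[of "length U - d"] cyc_neg[of d U] assms n_le by simp

text \<open>Going back from the start of the concatenation one first reads the end of
  \<open>\<beta>\<close>. If \<open>\<beta>\<close> is shorter than \<open>d\<close>, the reading
  continues into the end of \<open>U\<close>, where \<open>before\<close> lets it stand for another
  turn around \<open>\<beta>\<close>.\<close>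

lemma cyc_append_before:
  assumes d: "1 \<le> d" "d \<le> n"
  shows "cyc (U @ \<beta>) (- int d) = cyc \<beta> (- int d)"
proof (cases "d \<le> length \<beta>")
  case True
  then show ?thesis
    using d n_le cyc_neg[of d "U @ \<beta>"] cyc_neg[of d \<beta>] by (auto simp: nth_append)
next
  case False
  \<comment> \<open>The distance left after passing through \<open>\<beta>\<close>; since
    \<open>r < length \<beta>\<close> and \<open>d \<le> n\<close>, it is below
    \<open>n - r\<close>.\<close>
  define e where "e = d - length \<beta>"
  have e: "1 \<le> e" "e < n - r" "e \<le> n" "d = e + length \<beta>"
    using False d r by (auto simp: e_def)
  have "cyc (U @ \<beta>) (- int d) = cyc (U @ \<beta>) (- int d + int (length (U @ \<beta>)))"
    by (rule cyc_add_length[symmetric])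
  also have "\<dots> = cyc (U @ \<beta>) (int (length U) - int e)"
    by (simp add: e(4))
  also have "\<dots> = cyc \<beta> (- int e)"
    using e by (simp add: cyc_append_before_right before)
  also have "\<dots> = cyc \<beta> (- int d + int (length \<beta>))"
    by (simp add: e(4))
  also have "\<dots> = cyc \<beta> (- int d)"
    by (rule cyc_add_length)
  finally show ?thesis .
qed

text \<open>A window ending inside the run moves to the end \<open>length U + p\<close>: there it is
  still preceded by the end of \<open>U\<close>, and the run symbols of \<open>\<beta>\<close>
  replace those of \<open>U\<close>. Every other window keeps its end \<open>p\<close>.\<close>

lemma window_left_occurs_in_append:
  assumes p: "p < length U"
  shows "\<exists>q. window_ending n U (int p) = window_ending n (U @ \<beta>) q"
proof (cases "p < r")
  case True
  have "cyc U (int p - int d) = cyc (U @ \<beta>) (int (length U) + int p - int d)" if "d < n" for d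
  proof (cases "d \<le> p")
    case True
    then show ?thesis
      using cyc_append_right[of "p - d"] cyc_nonneg[of "p - d" U] run_U[of "p - d"] run_\<beta>[of "p - d"]
        \<open>p < r\<close> p r by (simp add: add_diff_eq)
  next
    case False
    then show ?thesis
      using cyc_append_before_right[of "d - p"] that by (simp add: algebra_simps)
  qed
  then show ?thesis by (blast intro: window_ending_cong)
next
  case False
  have "cyc U (int p - int d) = cyc (U @ \<beta>) (int p - int d)" if "d < n" for d
  proof (cases "d \<le> p")
    case True
    then show ?thesis
      using cyc_append_left[of "p - d"] cyc_nonneg[of "p - d" U] p by simp
  next
    case d: False
    \<comment> \<open>From \<open>r \<le> p\<close> and \<open>d < n\<close> the distance before the
      start is below \<open>n - r\<close>, the range in which \<open>before\<close> applies.\<close>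
    then have "1 \<le> d - p" "d - p < n - r" "d - p \<le> n" using False that by auto
    then show ?thesis
      using cyc_append_before[of "d - p"] before[of "d - p"] d by simp
  qed
  then show ?thesis by (blast intro: window_ending_cong)
qed

text \<open>The mirror image: a window ending inside the run is found at the end \<open>p\<close> in
  \<open>U\<close>, preceded cyclically by the end of \<open>\<beta>\<close>. The others are shifted
  by \<open>length U\<close>, where the end of \<open>U\<close> stands in for that of
  \<open>\<beta>\<close>.\<close>

lemma window_right_occurs_in_append:
  assumes p: "p < length \<beta>"
  shows "\<exists>q. window_ending n \<beta> (int p) = window_ending n (U @ \<beta>) q"
proof (cases "p < r")
  case True
  have "cyc \<beta> (int p - int d) = cyc (U @ \<beta>) (int p - int d)" if "d < n" for d
  proof (cases "d \<le> p")
    case True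
    then show ?thesis
      using cyc_append_left[of "p - d"] cyc_nonneg[of "p - d" \<beta>] run_U[of "p - d"] run_\<beta>[of "p - d"]
        \<open>p < r\<close> p r n_le by simp
  next
    case False
    then show ?thesis
      using cyc_append_before[of "d - p"] that by simp
  qed
  then show ?thesis by (blast intro: window_ending_cong)
next
  case False
  have "cyc \<beta> (int p - int d) = cyc (U @ \<beta>) (int (length U) + int p - int d)" if "d < n" for d
  proof (cases "d \<le> p")
    case True
    then show ?thesis
      using cyc_append_right[of "p - d"] cyc_nonneg[of "p - d" \<beta>] p
      by (simp add: add_diff_eq)
  next
    case d: False
    then have "1 \<le> d - p" "d - p < n - r" "d - p \<le> n" using False that by auto
    then show ?thesis
      using cyc_append_before_right[of "d - p"] before[of "d - p"] d
      by (simp add: algebra_simps)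
  qed
  then show ?thesis by (blast intro: window_ending_cong)
qed

end

section \<open>Joining universal cycles one at a time\<close>

lemma universal_cycle_append:
  assumes U: "universal_cycle k n S U" and \<beta>: "universal_cycle k n T \<beta>" and disj: "S \<inter> T = {}"
    and n_le: "n \<le> length U" and v: "v \<noteq> []"
    and suff: "suff n U = suff n (ext n v)"
    and rel: "suffix_related x n (ext n v) (ext n \<beta>)"
    and run: "run_prefix_length x \<beta> \<le> run_prefix_length x U"
  shows "universal_cycle k n (S \<union> T) (U @ \<beta>)"
    and "suff n (U @ \<beta>) = suff n (ext n \<beta>)"
proof -
  have ne: "U \<noteq> []" "\<beta> \<noteq> []"
    using U \<beta> universal_cycle_nonempty by blast+
  obtain r where r: "r < n" "r < length \<beta>" "r = run_prefix_length x \<beta>" "\<And>i. i < r \<Longrightarrow> \<beta> ! i = x"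
    "\<And>d. 1 \<le> d \<Longrightarrow> d < n - r \<Longrightarrow> cyc v (- int d) = cyc \<beta> (- int d)"
    using suffix_related_ext_obtain_run[OF rel v ne(2)] by blast
  have run_U: "U ! i = x" if "i < r" for i
    using nth_eq_of_run_prefix[of i x U] run r(3) that by simp
  \<comment> \<open>Here \<open>v\<close> is the cycle whose extension has the same last
    \<open>n\<close> symbols as \<open>U\<close>, so its suffix-relatedness to
    \<open>\<beta>\<close> passes to \<open>U\<close>.\<close>
  have "cyc U (- int d) = cyc v (- int d)" if "1 \<le> d" "d \<le> n" for d
    using suff suff_eq_suff_ext_iff[OF n_le length_ext(2)[OF v] v] that by blast
  then have before: "cyc U (- int d) = cyc \<beta> (- int d)" if "1 \<le> d" "d < n - r" for d
    using r(5)[OF that] that by simp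
  let ?W = "cyclic_window n (U @ \<beta>) ` {..<length (U @ \<beta>)}"
  have "S \<subseteq> cyclic_window n U ` {..<length U}"
    using U unfolding universal_cycle_iff_subset_windows by blast
  also have "\<dots> \<subseteq> ?W"
    using window_left_occurs_in_append[OF n_le r(1,2) run_U r(4) before] ne
    by (intro cyclic_windows_subsetI) auto
  finally have S: "S \<subseteq> ?W" .
  have "T \<subseteq> cyclic_window n \<beta> ` {..<length \<beta>}"
    using \<beta> unfolding universal_cycle_iff_subset_windows by blast
  also have "\<dots> \<subseteq> ?W"
    using window_right_occurs_in_append[OF n_le r(1,2) run_U r(4) before] ne
    by (intro cyclic_windows_subsetI) auto
  finally have T: "T \<subseteq> ?W" .
  have "card (S \<union> T) = card S + card T"
    using universal_cycle_finite[OF U] universal_cycle_finite[OF \<beta>] disj by (rule card_Un_disjoint)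
  then have "length (U @ \<beta>) = card (S \<union> T)"
    using U \<beta> by (simp add: universal_cycle_def)
  with Un_least[OF S T] show "universal_cycle k n (S \<union> T) (U @ \<beta>)"
    using U \<beta> unfolding universal_cycle_iff_subset_windows by simp
  show "suff n (U @ \<beta>) = suff n (ext n \<beta>)"
  proof (rule suff_eq_suff_ext_iff[THEN iffD2, OF _ length_ext(2)[OF ne(2)] ne(2)])
    show "\<forall>d. 1 \<le> d \<and> d \<le> n \<longrightarrow> cyc (U @ \<beta>) (- int d) = cyc \<beta> (- int d)"
      using cyc_append_before[OF n_le r(1,2) run_U r(4) before] by blast
  qed (use n_le in simp)
qed

lemma run_prefix_length_append: "run_prefix_length x u \<le> run_prefix_length x (u @ v)"
  by (induction u) (auto simp: run_prefix_length_def)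

theorem theorem1:
  fixes k n x :: nat and S :: "nat list set"
    and Ss :: "nat list set list" and \<alpha>s :: "nat list list"
  assumes "k \<ge> 2" and "n \<ge> 1"
    and "S \<subseteq> words k n" and "S \<noteq> {}"
    and "UC_partition k n S Ss"
    and "length \<alpha>s = length Ss"
    and "\<forall>i<length Ss. universal_cycle k n (Ss ! i) (\<alpha>s ! i)"
    and "x = hd (\<alpha>s ! 0)"
    and "length (\<alpha>s ! 0) \<ge> n"
    and "\<forall>i<length \<alpha>s. run_prefix_length x (\<alpha>s ! i) \<le> run_prefix_length x (\<alpha>s ! 0)"
    and "\<forall>i. Suc i < length \<alpha>s \<longrightarrow>
           suffix_related x n (ext n (\<alpha>s ! i)) (ext n (\<alpha>s ! Suc i))"
  shows "universal_cycle k n S (concat \<alpha>s) \<and>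
         suff n (concat \<alpha>s) = suff n (ext n (last \<alpha>s))"
proof -
  have part: "partition_on S (set Ss)" and dist: "distinct Ss"
    using assms(5) by (auto simp: UC_partition_def)
  have \<Union>: "\<Union> (set Ss) = S" using part by (simp add: partition_on_def)
  have ne: "Ss \<noteq> []" using \<Union> assms(4) by auto
  have uc: "universal_cycle k n (Ss ! i) (\<alpha>s ! i)" if "i < length Ss" for i
    using assms(7) that by blast
  \<comment> \<open>Besides the two claims, the induction carries the length and run bounds that
    \<open>universal_cycle_append\<close> demands of the left word. Both survive appending. The
    suffix claim for \<open>\<alpha>s ! i\<close> lets that cycle serve as \<open>v\<close> in the
    next step.\<close>
  have prefix: "universal_cycle k n (\<Union> (set (take (Suc i) Ss))) (concat (take (Suc i) \<alpha>s)) \<and>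
      n \<le> length (concat (take (Suc i) \<alpha>s)) \<and>
      run_prefix_length x (\<alpha>s ! 0) \<le> run_prefix_length x (concat (take (Suc i) \<alpha>s)) \<and>
      suff n (concat (take (Suc i) \<alpha>s)) = suff n (ext n (\<alpha>s ! i))"
    if "i < length Ss" for i
    using that
  proof (induction i)
    case 0
    have "\<alpha>s ! 0 \<noteq> []" using uc[OF 0] universal_cycle_nonempty by blast
    \<comment> \<open>As \<open>\<alpha>s ! 0\<close> has length at least \<open>n\<close>, both
      sides read the same negative cyclic positions of it.\<close>
    then have "suff n (\<alpha>s ! 0) = suff n (ext n (\<alpha>s ! 0))"
      using suff_eq_suff_ext_iff[of n "\<alpha>s ! 0" n "\<alpha>s ! 0"] length_ext(2) assms(9) by blast
    then show ?case
      using 0 assms(6,9) uc[OF 0] by (simp add: take_Suc_conv_app_nth)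
  next
    case (Suc i)
    let ?U = "concat (take (Suc i) \<alpha>s)" and ?T = "\<Union> (set (take (Suc i) Ss))"
    have IH: "universal_cycle k n ?T ?U" "n \<le> length ?U"
      "run_prefix_length x (\<alpha>s ! 0) \<le> run_prefix_length x ?U" "suff n ?U = suff n (ext n (\<alpha>s ! i))"
      using Suc by auto
    have "A \<inter> Ss ! Suc i = {}" if A: "A \<in> set (take (Suc i) Ss)" for A
    proof -
      obtain l where l: "l < Suc i" "A = Ss ! l"
        using A Suc.prems by (auto simp: in_set_conv_nth)
      then have "A \<noteq> Ss ! Suc i"
        using dist Suc.prems by (simp add: nth_eq_iff_index_eq)
      then show ?thesis
        using part l Suc.prems unfolding partition_on_def disjoint_def
        by (metis less_trans nth_mem)
    qed
    then have disj: "?T \<inter> Ss ! Suc i = {}" by blast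
    have "\<alpha>s ! i \<noteq> []"
      using uc[of i] universal_cycle_nonempty Suc.prems by fastforce
    moreover have "suffix_related x n (ext n (\<alpha>s ! i)) (ext n (\<alpha>s ! Suc i))"
      using assms(6,11) Suc.prems by simp
    moreover have "run_prefix_length x (\<alpha>s ! Suc i) \<le> run_prefix_length x ?U"
      using assms(6,10) IH(3) Suc.prems by (metis order_trans)
    ultimately have app: "universal_cycle k n (?T \<union> Ss ! Suc i) (?U @ \<alpha>s ! Suc i)"
      "suff n (?U @ \<alpha>s ! Suc i) = suff n (ext n (\<alpha>s ! Suc i))"
      using universal_cycle_append[OF IH(1) uc[OF Suc.prems] disj IH(2) _ IH(4)] by blast+
    have take: "concat (take (Suc (Suc i)) \<alpha>s) = ?U @ \<alpha>s ! Suc i"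
      "\<Union> (set (take (Suc (Suc i)) Ss)) = ?T \<union> Ss ! Suc i"
      using take_Suc_conv_app_nth[of "Suc i" \<alpha>s] take_Suc_conv_app_nth[of "Suc i" Ss]
        Suc.prems assms(6) by (simp_all add: Un_commute del: take_Suc)
    show ?case
      unfolding take using app IH(2,3) run_prefix_length_append[of x ?U "\<alpha>s ! Suc i"] by auto
  qed
  have "Suc (length Ss - 1) = length Ss" using ne by simp
  moreover have "last \<alpha>s = \<alpha>s ! (length Ss - 1)"
    using ne assms(6) by (metis last_conv_nth length_0_conv)
  ultimately show ?thesis
    using prefix[of "length Ss - 1"] ne \<Union> assms(6) by simp
qed

end
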